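(* Let $c,d\in\mathbb{R}$ and consider tropical meromorphic solutions $F$ of $$F(x+1)-cF(x)+dF(x-1)=0\qquad\text{for all }x\in\mathbb{R}.\qquad( * )$$ (1) If $c=2$, $d=1$, then every tropical meromorphic solution $F$ of $( * )$ is a linear combination of $1$-periodic tropical meromorphic functions $\Pi(x)$, the function $L(x)= x$, and functions $\Phi(x,\Pi_0)=[x]\Pi_0(x)$, where $\Pi_0$ is a $1$-periodic tropical meromorphic function with $\Pi_0(0)=0$. (2) If $c=-2$, $d=1$, then every tropical meromorphic solution $F$ of $( * )$ is a linear combination of tropical meromorphic functions each of which is either $2$-periodic and anti-$1$-periodic, or of the form $[x-x_0]\,\Xi(x)$, where $x_0\in\mathbb{R}$ and $\Xi$ is a $2$-periodic, anti-$1$-periodic tropical meromorphic function with $\Xi(x_0)=0$. (3) If $c^2-4d=0$, $d\neq 0,1$ and $c<0$, then every tropical meromorphic solution $F$ of $( * )$ is a finite linear combination of functions each of which is either of the form $e_{c/2}(x-b)$ with $b\in[0,1)$, or of the form $[x-b_0]\,e_{c/2}(x-b)$ with $b\in[0,1)$ and $b_0\in\mathbb{R}$ such that $e_{c/2}(b_0-b)=0$. (4) If $c^2-4d=0$, $d\neq 0,1$ and $c>0$, then every finite linear combination of functions $e_{c/2}(x-b)$, $b\in[0,1)$, is a solution of $( * )$. (5) If $c^2-4d>0$, $d\neq0,1$ and $1-c+d\neq 0$, then every tropical meromorphic solution $F$ of $( * )$ is a finite linear combination of functions of the form $e_\alpha(x-b)$ and $e_\beta(x-b)$ with $b\in[0,1)$,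 where $\alpha,\beta$ are the roots of $\lambda^2-c\lambda+d=0$.
   Context: A tropical meromorphic function is a continuous piecewise linear function $f:\mathbb{R}\to\mathbb{R}$ (arbitrary real slopes, points of slope change having no accumulation point in $\mathbb{R}$). Anti-$1$-periodic means $\Xi(x+1)=-\Xi(x)$ for all $x$. $[x]$ is the integer part (floor) of $x$. Linear combinations are finite with real coefficients. Tropical exponentials: for real $\gamma$ with $|\gamma|>1$, $e_\gamma(x)=\gamma^{[x]}\left(x-[x]+\frac{1}{\gamma-1}\right)$; for real $\gamma$ with $0<|\gamma|<1$, $e_\gamma(x)=\gamma^{[x]}\left(\frac{1}{1-\gamma}-x+[x]\right)$; for $\gamma=-1$ the first formula is used, i.e. $e_{-1}(x)=(-1)^{[x]}\left(x-[x]-\frac12\right)$. *)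

theory Defs
  imports "HOL-Analysis.Analysis"
begin

text \<open>A point is a point of slope change if no neighbourhood of it carries \<open>f\<close> as a single
  affine function. Where these points do not accumulate, a continuous function is affine on each
  closed interval between consecutive ones, so the last definition below includes piecewise
  linearity.\<close>

definition locally_affine_at :: "(real \<Rightarrow> real) \<Rightarrow> real \<Rightarrow> bool" where
  "locally_affine_at f x \<longleftrightarrow> (\<exists>m k. \<forall>\<^sub>F y in nhds x. f y = m * y + k)"

definition slope_change_points :: "(real \<Rightarrow> real) \<Rightarrow> real set" where
  "slope_change_points f = {x. \<not> locally_affine_at f x}"

definition tropical_meromorphic :: "(real \<Rightarrow> real) \<Rightarrow> bool" where
  "tropical_meromorphic f \<longleftrightarrow>
     continuous_on UNIV f \<and> (\<forall>x. \<not> x islimpt slope_change_points f)"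

definition periodic :: "real \<Rightarrow> (real \<Rightarrow> real) \<Rightarrow> bool" where
  "periodic p f \<longleftrightarrow> (\<forall>x. f (x + p) = f x)"

definition anti_periodic :: "real \<Rightarrow> (real \<Rightarrow> real) \<Rightarrow> bool" where
  "anti_periodic p f \<longleftrightarrow> (\<forall>x. f (x + p) = - f x)"

text \<open>Tropical exponentials, meaningful for \<open>0 < \<bar>\<gamma>\<bar>\<close> with \<open>\<bar>\<gamma>\<bar> \<noteq> 1\<close>, and for \<open>\<gamma> = - 1\<close>.
  The values at \<open>\<gamma> = 0\<close> and \<open>\<gamma> = 1\<close> are junk.\<close>

definition tropical_exp :: "real \<Rightarrow> real \<Rightarrow> real" where
  "tropical_exp \<gamma> x =
     (if 0 < \<bar>\<gamma>\<bar> \<and> \<bar>\<gamma>\<bar> < 1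
      then \<gamma> powi \<lfloor>x\<rfloor> * (1 / (1 - \<gamma>) - x + of_int \<lfloor>x\<rfloor>)
      else \<gamma> powi \<lfloor>x\<rfloor> * (x - of_int \<lfloor>x\<rfloor> + 1 / (\<gamma> - 1)))"

definition linear_combinations :: "(real \<Rightarrow> real) set \<Rightarrow> (real \<Rightarrow> real) set" where
  "linear_combinations S =
     {f. \<exists>T a. finite T \<and> T \<subseteq> S \<and> f = (\<lambda>x. \<Sum>g\<in>T. a g * g x)}"

definition tropical_meromorphic_solution :: "real \<Rightarrow> real \<Rightarrow> (real \<Rightarrow> real) \<Rightarrow> bool" where
  "tropical_meromorphic_solution c d F \<longleftrightarrow>
     tropical_meromorphic F \<and> (\<forall>x. F (x + 1) - c * F x + d * F (x - 1) = 0)"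

end

theory Submission
  imports Defs
begin

text \<open>With \<open>\<alpha>, \<beta>\<close> the roots of \<open>\<lambda>\<^sup>2 - c \<lambda> + d\<close>, the operator
  in the equation factors into two first-order ones, so \<open>G x = F (x + 1) - \<beta> F x\<close> satisfies
  \<open>G (x + 1) = \<alpha> G x\<close>. If \<open>\<alpha> \<notin> {0, 1}\<close>, then \<open>e\<^sub>\<alpha> (x - b)\<close> satisfies the same
  first-order equation and changes slope exactly on \<open>b + \<int>\<close>. Subtracting suitable multiples of
  these functions for the finitely many points \<open>b \<in> [0, 1)\<close> of slope change of \<open>G\<close> leaves an affine
  function, and the first-order equation forces it to vanish. For distinct roots, \<open>F\<close> is the
  difference of the two possible functions \<open>G\<close>, divided by \<open>\<alpha> - \<beta>\<close>. For a double root, \<open>F\<close> differs by a solution of the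
  first-order equation from a combination of products of \<open>G\<close>, or its summands, with a shifted floor
  function; such a product is continuous because the shift places the jumps at zeros.\<close>

section \<open>One-sided slopes\<close>

text \<open>Measuring both sides from the single value \<open>f x\<close> builds continuity at
  \<open>x\<close> into the condition.\<close>

definition one_sided_slopes :: "(real \<Rightarrow> real) \<Rightarrow> real \<Rightarrow> real \<Rightarrow> real \<Rightarrow> bool" where
  "one_sided_slopes f x l r \<longleftrightarrow>
     (\<forall>\<^sub>F y in nhds x. f y = f x + (if y < x then l else r) * (y - x))"

text \<open>The derivative of \<open>f\<close> exists and is locally constant, so
  \<open>deriv f\<close> has derivative 0. On a convex set this makes first \<open>deriv f\<close>
  and then \<open>f x - m * x\<close> constant.\<close>

lemma locally_affine_on_imp_affine:
  assumes cS: "convex S" and aff: "\<And>x. x \<in> S \<Longrightarrow> locally_affine_at f x"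
  obtains m k where "\<And>x. x \<in> S \<Longrightarrow> f x = m * x + k"
proof -
  have d: "\<exists>m. (f has_field_derivative m) (at x) \<and> (\<forall>\<^sub>F y in nhds x. deriv f y = m)"
    if "x \<in> S" for x
  proof -
    obtain m k where "\<forall>\<^sub>F y in nhds x. f y = m * y + k"
      using aff \<open>x \<in> S\<close> unfolding locally_affine_at_def by blast
    then have ev: "\<forall>\<^sub>F z in nhds x. \<forall>\<^sub>F y in nhds z. f y = m * y + k"
      by (simp add: eventually_eventually)
    have D: "(f has_field_derivative m) (at z)" if "\<forall>\<^sub>F y in nhds z. f y = m * y + k" for z
      by (rule DERIV_cong_ev[THEN iffD2, OF refl that refl]) (auto intro!: derivative_eq_intros)
    from ev have "\<forall>\<^sub>F y in nhds x. deriv f y = m"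
      by (rule eventually_mono) (rule DERIV_imp_deriv[OF D])
    moreover have "(f has_field_derivative m) (at x)" by (rule D[OF eventually_nhds_x_imp_x[OF ev]])
    ultimately show ?thesis by blast
  qed
  have dd: "(deriv f has_field_derivative 0) (at x within S)" if x: "x \<in> S" for x
  proof -
    obtain m where "\<forall>\<^sub>F y in nhds x. deriv f y = m" using d x by blast
    then have "(deriv f has_field_derivative 0) (at x)"
      by (rule DERIV_cong_ev[THEN iffD2, OF refl _ refl]) auto
    then show ?thesis by (rule has_field_derivative_at_within)
  qed
  obtain m where m: "\<And>x. x \<in> S \<Longrightarrow> deriv f x = m"
    using has_field_derivative_zero_constant[OF cS dd] by blast
  have "((\<lambda>x. f x - m * x) has_field_derivative 0) (at x within S)" if x: "x \<in> S" for x
  proof -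
    obtain m' where m': "(f has_field_derivative m') (at x)" using d[OF x] by blast
    with DERIV_imp_deriv[OF m'] m[OF x] have "(f has_field_derivative m) (at x)" by simp
    from has_field_derivative_at_within[OF this] show ?thesis
      by (auto intro!: derivative_eq_intros)
  qed
  from has_field_derivative_zero_constant[OF cS this]
  obtain k where "\<And>x. x \<in> S \<Longrightarrow> f x - m * x = k" by blast
  then have "\<And>x. x \<in> S \<Longrightarrow> f x = m * x + k" by (metis add.commute diff_add_cancel)
  then show thesis using that by blast
qed

text \<open>This pointwise form replaces bookkeeping with sets of slope-change points by
  computations near one point. Forwards, isolation of slope changes gives an affine piece on each
  side of \<open>x\<close>; backwards, the formula gives continuity and leaves no other slope change
  nearby.\<close>

lemma tropical_meromorphic_iff_slopes:
  "tropical_meromorphic f \<longleftrightarrow> (\<forall>x. \<exists>l r. one_sided_slopes f x l r)"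
proof
  assume tm: "tropical_meromorphic f"
  show "\<forall>x. \<exists>l r. one_sided_slopes f x l r"
  proof
    fix x
    have cont: "continuous_on UNIV f" and "\<not> x islimpt slope_change_points f"
      using tm by (auto simp: tropical_meromorphic_def)
    then obtain e where e: "e > 0"
      and aff: "\<And>y. y \<noteq> x \<Longrightarrow> \<bar>y - x\<bar> < e \<Longrightarrow> locally_affine_at f y"
      unfolding islimpt_approachable slope_change_points_def by (auto simp: dist_real_def)
    \<comment> \<open>The set \<open>A\<close> is arbitrary so that one limit serves both sides.
      Each affine piece agrees with \<open>f\<close> on its side, so uniqueness of limits makes its
      value at \<open>x\<close> equal to \<open>f x\<close>.\<close>
    have lim: "((\<lambda>y. f y - (m * y + k)) \<longlongrightarrow> f x - (m * x + k)) (at x within A)" for m k A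
      using cont by (intro tendsto_intros) (meson continuous_on continuous_within UNIV_I
        continuous_at_imp_continuous_within continuous_on_eq_continuous_at open_UNIV)
    obtain l k where l: "\<And>y. x - e < y \<Longrightarrow> y < x \<Longrightarrow> f y = l * y + k"
      by (rule locally_affine_on_imp_affine[of "{x - e<..<x}" f]) (auto intro: aff)
    obtain r k' where r: "\<And>y. x < y \<Longrightarrow> y < x + e \<Longrightarrow> f y = r * y + k'"
      by (rule locally_affine_on_imp_affine[of "{x<..<x + e}" f]) (auto intro: aff)
    have "\<forall>\<^sub>F y in at_left x. f y - (l * y + k) = 0"
      unfolding eventually_at_left_field using l e by (intro exI[of _ "x - e"]) auto
    then have "f x - (l * x + k) = 0"
      by (intro tendsto_unique[OF _ lim tendsto_eventually]) auto
    moreover have "\<forall>\<^sub>F y in at_right x. f y - (r * y + k') = 0"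
      unfolding eventually_at_right_field using r e by (intro exI[of _ "x + e"]) auto
    then have "f x - (r * x + k') = 0"
      by (intro tendsto_unique[OF _ lim tendsto_eventually]) auto
    ultimately have "f y = f x + (if y < x then l else r) * (y - x)" if "dist y x < e" for y
      using that l[of y] r[of y] by (cases y x rule: linorder_cases)
        (auto simp: dist_real_def algebra_simps abs_if split: if_splits)
    then have "one_sided_slopes f x l r"
      unfolding one_sided_slopes_def eventually_nhds_metric using e by blast
    then show "\<exists>l r. one_sided_slopes f x l r" by blast
  qed
next
  assume sl: "\<forall>x. \<exists>l r. one_sided_slopes f x l r"
  have "isCont f x \<and> \<not> x islimpt slope_change_points f" for x
  proof -
    obtain l r where "one_sided_slopes f x l r" using sl by blast
    then obtain e where e: "e > 0"
      and eq: "\<And>y. dist y x < e \<Longrightarrow> f y = f x + (if y < x then l else r) * (y - x)"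
      unfolding one_sided_slopes_def eventually_nhds_metric by blast
    \<comment> \<open>Using \<open>min\<close> and \<open>max\<close> turns the case distinction
      into a visibly continuous expression.\<close>
    let ?g = "\<lambda>y. f x + (l * min (y - x) 0 + r * max (y - x) 0)"
    have "f y = ?g y" if "dist y x < e" for y
      using eq[OF that] by (cases "y < x") simp_all
    then have "\<forall>\<^sub>F y in nhds x. f y = ?g y"
      unfolding eventually_nhds_metric using e by blast
    then have "isCont f x = isCont ?g x" by (rule isCont_cong)
    moreover have "isCont ?g x" by (intro continuous_intros)
    moreover have "\<not> x islimpt slope_change_points f"
    proof -
      have "locally_affine_at f y" if y: "dist y x < e" "y \<noteq> x" for y
      proof -
        let ?m = "if y < x then l else r"
        have "\<forall>\<^sub>F z in nhds y. z \<in> ball x e \<and> (z < x \<longleftrightarrow> y < x)"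
        proof (cases "y < x")
          case True
          then have "\<forall>\<^sub>F z in nhds y. z \<in> ball x e \<inter> {..<x}"
            by (intro eventually_nhds_in_open) (use y in \<open>auto simp: dist_commute\<close>)
          then show ?thesis by eventually_elim (use True in auto)
        next
          case False
          then have "\<forall>\<^sub>F z in nhds y. z \<in> ball x e \<inter> {x<..}"
            by (intro eventually_nhds_in_open) (use y in \<open>auto simp: dist_commute\<close>)
          then show ?thesis by eventually_elim (use False in auto)
        qed
        then have "\<forall>\<^sub>F z in nhds y. f z = ?m * z + (f x - ?m * x)"
        proof eventually_elim
          case (elim z)
          then have "f z = f x + ?m * (z - x)" using eq[of z] by (simp add: dist_commute)
          then show ?case by (simp add: algebra_simps)
        qed
        then show ?thesis unfolding locally_affine_at_def by blast
      qed
      then show ?thesis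
        unfolding islimpt_approachable slope_change_points_def using e by blast
    qed
    ultimately show ?thesis by blast
  qed
  then show "tropical_meromorphic f"
    unfolding tropical_meromorphic_def by (simp add: continuous_at_imp_continuous_on)
qed

text \<open>One-sided slopes are linear in the function, so in this form removing a slope change
  means solving a linear equation for a coefficient.\<close>

lemma locally_affine_at_iff_slopes: "locally_affine_at f x \<longleftrightarrow> (\<exists>m. one_sided_slopes f x m m)"
proof
  assume "locally_affine_at f x"
  then obtain m k where ev: "\<forall>\<^sub>F y in nhds x. f y = m * y + k"
    unfolding locally_affine_at_def by blast
  have "f x = m * x + k" using eventually_nhds_x_imp_x[OF ev] .
  then have "one_sided_slopes f x m m"
    unfolding one_sided_slopes_def by (intro eventually_mono[OF ev]) (simp add: algebra_simps)
  then show "\<exists>m. one_sided_slopes f x m m" by blast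
next
  assume "\<exists>m. one_sided_slopes f x m m"
  then obtain m where ev: "\<forall>\<^sub>F y in nhds x. f y = f x + m * (y - x)"
    unfolding one_sided_slopes_def by auto
  then have "\<forall>\<^sub>F y in nhds x. f y = m * y + (f x - m * x)"
    by eventually_elim (simp add: algebra_simps)
  then show "locally_affine_at f x" unfolding locally_affine_at_def by blast
qed

section \<open>Closure properties under sums, scalar multiples and shifts\<close>

lemma one_sided_slopes_add:
  assumes "one_sided_slopes f x l r" "one_sided_slopes g x l' r'"
  shows "one_sided_slopes (\<lambda>x. f x + g x) x (l + l') (r + r')"
  using assms unfolding one_sided_slopes_def
proof eventually_elim
  case (elim y)
  show ?case unfolding elim by (cases "y < x") (simp_all add: algebra_simps)
qed

lemma one_sided_slopes_cmult:
  assumes "one_sided_slopes f x l r"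
  shows "one_sided_slopes (\<lambda>x. a * f x) x (a * l) (a * r)"
  using assms unfolding one_sided_slopes_def
proof eventually_elim
  case (elim y)
  show ?case unfolding elim by (cases "y < x") (simp_all add: algebra_simps)
qed

lemma one_sided_slopes_shift:
  assumes "one_sided_slopes f (x + a) l r"
  shows "one_sided_slopes (\<lambda>x. f (x + a)) x l r"
proof -
  have "filterlim (\<lambda>y. y + a) (nhds (x + a)) (nhds x)"
    by (intro tendsto_intros filterlim_ident)
  from eventually_compose_filterlim[OF assms[unfolded one_sided_slopes_def] this]
  show ?thesis unfolding one_sided_slopes_def by simp
qed

lemma tropical_meromorphic_add:
  assumes "tropical_meromorphic f" "tropical_meromorphic g"
  shows "tropical_meromorphic (\<lambda>x. f x + g x)"
proof -
  obtain l r l' r' where "\<And>x. one_sided_slopes f x (l x) (r x)"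
    "\<And>x. one_sided_slopes g x (l' x) (r' x)"
    using assms unfolding tropical_meromorphic_iff_slopes by metis
  from one_sided_slopes_add[OF this] show ?thesis
    unfolding tropical_meromorphic_iff_slopes by blast
qed

lemma tropical_meromorphic_cmult:
  assumes "tropical_meromorphic f"
  shows "tropical_meromorphic (\<lambda>x. a * f x)"
proof -
  obtain l r where "\<And>x. one_sided_slopes f x (l x) (r x)"
    using assms unfolding tropical_meromorphic_iff_slopes by metis
  from one_sided_slopes_cmult[OF this] show ?thesis
    unfolding tropical_meromorphic_iff_slopes by blast
qed

lemma tropical_meromorphic_diff:
  "tropical_meromorphic f \<Longrightarrow> tropical_meromorphic g \<Longrightarrow> tropical_meromorphic (\<lambda>x. f x - g x)"
  using tropical_meromorphic_add[OF _ tropical_meromorphic_cmult[of g "- 1"]] by simp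

lemma tropical_meromorphic_shift:
  assumes "tropical_meromorphic f"
  shows "tropical_meromorphic (\<lambda>x. f (x + a))"
proof -
  obtain l r where "\<And>x. one_sided_slopes f x (l x) (r x)"
    using assms unfolding tropical_meromorphic_iff_slopes by metis
  from one_sided_slopes_shift[OF this] show ?thesis
    unfolding tropical_meromorphic_iff_slopes by blast
qed

lemma tropical_meromorphic_affine: "tropical_meromorphic (\<lambda>x. m * x + k)"
proof -
  have "one_sided_slopes (\<lambda>x. m * x + k) x m m" for x
    unfolding one_sided_slopes_def by (simp add: algebra_simps)
  then show ?thesis unfolding tropical_meromorphic_iff_slopes by blast
qed

lemma tropical_meromorphic_sum:
  assumes "\<And>i. i \<in> A \<Longrightarrow> tropical_meromorphic (f i)"
  shows "tropical_meromorphic (\<lambda>x. \<Sum>i\<in>A. f i x)"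
  using assms
proof (induction A rule: infinite_finite_induct)
  case (insert i A)
  then show ?case by (simp add: tropical_meromorphic_add)
qed (use tropical_meromorphic_affine[of 0 0] in simp_all)

lemma locally_affine_at_add:
  assumes "locally_affine_at f x" "locally_affine_at g x"
  shows "locally_affine_at (\<lambda>x. f x + g x) x"
proof -
  obtain m m' where "one_sided_slopes f x m m" "one_sided_slopes g x m' m'"
    using assms unfolding locally_affine_at_iff_slopes by blast
  from one_sided_slopes_add[OF this] show ?thesis
    unfolding locally_affine_at_iff_slopes by blast
qed

lemma locally_affine_at_cmult:
  assumes "locally_affine_at f x"
  shows "locally_affine_at (\<lambda>x. a * f x) x"
proof -
  obtain m where "one_sided_slopes f x m m"
    using assms unfolding locally_affine_at_iff_slopes by blast
  from one_sided_slopes_cmult[OF this] show ?thesis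
    unfolding locally_affine_at_iff_slopes by blast
qed

lemma locally_affine_at_shift:
  assumes "locally_affine_at f (x + a)"
  shows "locally_affine_at (\<lambda>x. f (x + a)) x"
proof -
  obtain m where "one_sided_slopes f (x + a) m m"
    using assms unfolding locally_affine_at_iff_slopes by blast
  from one_sided_slopes_shift[OF this] show ?thesis
    unfolding locally_affine_at_iff_slopes by blast
qed

lemma locally_affine_at_sum:
  assumes "\<And>i. i \<in> A \<Longrightarrow> locally_affine_at (f i) x"
  shows "locally_affine_at (\<lambda>x. \<Sum>i\<in>A. f i x) x"
proof -
  have "locally_affine_at (\<lambda>x. 0) x"
    unfolding locally_affine_at_def by (intro exI[of _ 0]) simp
  with assms show ?thesis
  proof (induction A rule: infinite_finite_induct)
    case (insert i A)
    then show ?case by (simp add: locally_affine_at_add)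
  qed simp_all
qed

section \<open>Products with the floor function and tropical exponentials\<close>

text \<open>The open interval from \<open>\<lceil>x\<rceil> - 1\<close> to
  \<open>\<lfloor>x\<rfloor> + 1\<close> contains \<open>x\<close> and no integer except possibly
  \<open>x\<close>. The two values differ exactly when \<open>x\<close> is an integer.\<close>

lemma eventually_floor_eq:
  fixes x :: real
  shows "\<forall>\<^sub>F y in nhds x. \<lfloor>y\<rfloor> = (if y < x then \<lceil>x\<rceil> - 1 else \<lfloor>x\<rfloor>)"
proof -
  have "\<forall>\<^sub>F y in nhds x. y \<in> {of_int \<lceil>x\<rceil> - 1<..<of_int \<lfloor>x\<rfloor> + 1}"
    by (intro eventually_nhds_in_open) (auto, linarith)
  then show ?thesis
  proof eventually_elim
    case (elim y)
    then show ?case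
      by (auto simp: floor_eq_iff) linarith+
  qed
qed

text \<open>The floor factor jumps only on \<open>a + \<int>\<close>, where \<open>f\<close>
  vanishes, so both one-sided formulas start from the same value; elsewhere it merely rescales the
  slopes of \<open>f\<close>.\<close>

lemma tropical_meromorphic_floor_mult:
  assumes f: "tropical_meromorphic f" and zero: "\<And>n. f (a + of_int n) = 0"
  shows "tropical_meromorphic (\<lambda>x. of_int \<lfloor>x - a\<rfloor> * f x)"
  unfolding tropical_meromorphic_iff_slopes
proof
  fix x
  obtain l r where s: "one_sided_slopes f x l r"
    using f unfolding tropical_meromorphic_iff_slopes by blast
  let ?A = "\<lceil>x - a\<rceil> - 1" and ?B = "\<lfloor>x - a\<rfloor>"
  have AB: "of_int ?A * f x = of_int ?B * f x"
  proof (cases "x - a \<in> \<int>")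
    case True
    then obtain n where "x = a + of_int n" by (auto elim!: Ints_cases simp: algebra_simps)
    then show ?thesis using zero by simp
  next
    case False
    then show ?thesis by (simp add: ceiling_altdef) (metis Ints_of_int)
  qed
  have "filterlim (\<lambda>y. y - a) (nhds (x - a)) (nhds x)"
    by (intro tendsto_intros filterlim_ident)
  from eventually_compose_filterlim[OF eventually_floor_eq this]
  have fl: "\<forall>\<^sub>F y in nhds x. \<lfloor>y - a\<rfloor> = (if y < x then ?A else ?B)" by simp
  have "\<forall>\<^sub>F y in nhds x. of_int \<lfloor>y - a\<rfloor> * f y =
      of_int ?B * f x + (if y < x then of_int ?A * l else of_int ?B * r) * (y - x)"
    using fl s[unfolded one_sided_slopes_def]
  proof eventually_elim
    case (elim y)
    show ?case
    proof (cases "y < x")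
      case True
      then have "of_int \<lfloor>y - a\<rfloor> * f y = of_int ?A * f x + of_int ?A * l * (y - x)"
        using elim by (simp only: if_True distrib_left mult.assoc)
      then show ?thesis using True AB by simp
    qed (use elim in \<open>simp add: distrib_left\<close>)
  qed
  then show "\<exists>l r. one_sided_slopes (\<lambda>x. of_int \<lfloor>x - a\<rfloor> * f x) x l r"
    unfolding one_sided_slopes_def by blast
qed

text \<open>The two defining branches differ only by a sign. Pulling it out leaves one formula for
  all nonzero \<open>\<gamma>\<close>.\<close>

lemma tropical_exp_altdef:
  assumes "\<gamma> \<noteq> 0"
  shows "tropical_exp \<gamma> x = (if \<bar>\<gamma>\<bar> < 1 then - 1 else 1) *
    (\<gamma> powi \<lfloor>x\<rfloor> * (x - of_int \<lfloor>x\<rfloor> + 1 / (\<gamma> - 1)))"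
proof -
  have "1 / (1 - \<gamma>) = - (1 / (\<gamma> - 1))" by (metis minus_diff_eq minus_divide_right)
  then show ?thesis using assms by (simp add: tropical_exp_def algebra_simps)
qed

lemma tropical_exp_plus_1: "\<gamma> \<noteq> 0 \<Longrightarrow> tropical_exp \<gamma> (x + 1) = \<gamma> * tropical_exp \<gamma> x"
  by (simp add: tropical_exp_altdef power_int_add_1)

text \<open>The constant \<open>1 / (\<gamma> - 1)\<close> makes adjacent pieces meet: at an integer
  \<open>n\<close> the left one gives
  \<open>\<gamma> powi (n - 1) * (1 + 1 / (\<gamma> - 1))\<close>, which equals the right value
  \<open>\<gamma> powi n / (\<gamma> - 1)\<close>. Only the slope jumps, by the factor
  \<open>\<gamma>\<close>.\<close>

lemma one_sided_slopes_tropical_exp: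
  assumes "\<gamma> \<noteq> 0" "\<gamma> \<noteq> 1"
  shows "one_sided_slopes (tropical_exp \<gamma>) x
    ((if \<bar>\<gamma>\<bar> < 1 then - 1 else 1) * \<gamma> powi (\<lceil>x\<rceil> - 1))
    ((if \<bar>\<gamma>\<bar> < 1 then - 1 else 1) * \<gamma> powi \<lfloor>x\<rfloor>)"
proof -
  let ?h = "\<lambda>n x. \<gamma> powi n * (x - of_int n + 1 / (\<gamma> - 1))"
  have h: "?h (\<lceil>x\<rceil> - 1) x = ?h \<lfloor>x\<rfloor> x"
  proof (cases "x \<in> \<int>")
    case True
    then obtain n where x: "x = of_int n" by (auto elim: Ints_cases)
    have "\<gamma> powi n = \<gamma> powi (n - 1) * \<gamma>"
      using power_int_add_1[of \<gamma> "n - 1"] assms by simp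
    then show ?thesis using assms by (simp add: x field_simps)
  next
    case False
    then have "\<lceil>x\<rceil> - 1 = \<lfloor>x\<rfloor>" by (simp add: ceiling_altdef) (metis Ints_of_int)
    then show ?thesis by simp
  qed
  have step: "?h n y = ?h n x + \<gamma> powi n * (y - x)" for n y by (simp add: algebra_simps)
  have "\<forall>\<^sub>F y in nhds x. ?h \<lfloor>y\<rfloor> y =
      ?h \<lfloor>x\<rfloor> x + (if y < x then \<gamma> powi (\<lceil>x\<rceil> - 1) else \<gamma> powi \<lfloor>x\<rfloor>) * (y - x)"
    using eventually_floor_eq
  proof eventually_elim
    case (elim y)
    show ?case
    proof (cases "y < x")
      case True
      then have "\<lfloor>y\<rfloor> = \<lceil>x\<rceil> - 1" using elim by simp
      then show ?thesis using step[of "\<lceil>x\<rceil> - 1" y] h True by simp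
    next
      case False
      then have "\<lfloor>y\<rfloor> = \<lfloor>x\<rfloor>" using elim by simp
      then show ?thesis using step[of "\<lfloor>x\<rfloor>" y] False by simp
    qed
  qed
  then have "one_sided_slopes (\<lambda>y. ?h \<lfloor>y\<rfloor> y) x (\<gamma> powi (\<lceil>x\<rceil> - 1)) (\<gamma> powi \<lfloor>x\<rfloor>)"
    unfolding one_sided_slopes_def .
  from one_sided_slopes_cmult[OF this, of "if \<bar>\<gamma>\<bar> < 1 then - 1 else 1"]
  show ?thesis unfolding tropical_exp_altdef[OF assms(1), symmetric] .
qed

lemma tropical_meromorphic_tropical_exp:
  assumes "\<gamma> \<noteq> 0" "\<gamma> \<noteq> 1"
  shows "tropical_meromorphic (\<lambda>x. tropical_exp \<gamma> (x - b))"
proof -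
  have "tropical_meromorphic (tropical_exp \<gamma>)"
    using one_sided_slopes_tropical_exp[OF assms] unfolding tropical_meromorphic_iff_slopes by blast
  from tropical_meromorphic_shift[OF this, of "- b"] show ?thesis by simp
qed

section \<open>Linear combinations\<close>

lemma linear_combinations_cmult:
  assumes "f \<in> linear_combinations S"
  shows "(\<lambda>x. k * f x) \<in> linear_combinations S"
proof -
  obtain T a where T: "finite T" "T \<subseteq> S" "f = (\<lambda>x. \<Sum>g\<in>T. a g * g x)"
    using assms unfolding linear_combinations_def by blast
  have "(\<lambda>x. k * f x) = (\<lambda>x. \<Sum>g\<in>T. (k * a g) * g x)"
    by (simp add: T(3) sum_distrib_left mult.assoc)
  then show ?thesis unfolding linear_combinations_def using T(1,2)
    by (intro CollectI exI[of _ T] exI[of _ "\<lambda>g. k * a g"]) blast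
qed

lemma linear_combinations_add:
  assumes "f \<in> linear_combinations S" "h \<in> linear_combinations S"
  shows "(\<lambda>x. f x + h x) \<in> linear_combinations S"
proof -
  obtain T a where T: "finite T" "T \<subseteq> S" "f = (\<lambda>x. \<Sum>g\<in>T. a g * g x)"
    using assms(1) unfolding linear_combinations_def by blast
  obtain U b where U: "finite U" "U \<subseteq> S" "h = (\<lambda>x. \<Sum>g\<in>U. b g * g x)"
    using assms(2) unfolding linear_combinations_def by blast
  \<comment> \<open>A function may occur in both combinations, so coefficients are extended by 0 to
    \<open>T \<union> U\<close> before being added.\<close>
  let ?c = "\<lambda>g. (if g \<in> T then a g else 0) + (if g \<in> U then b g else 0)"
  have "(\<Sum>g\<in>T. a g * g x) = (\<Sum>g\<in>T \<union> U. (if g \<in> T then a g else 0) * g x)" for x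
    by (rule sum.mono_neutral_cong_left) (use T U in auto)
  moreover have "(\<Sum>g\<in>U. b g * g x) = (\<Sum>g\<in>T \<union> U. (if g \<in> U then b g else 0) * g x)" for x
    by (rule sum.mono_neutral_cong_left) (use T U in auto)
  ultimately have "(\<lambda>x. f x + h x) = (\<lambda>x. \<Sum>g\<in>T \<union> U. ?c g * g x)"
    unfolding T(3) U(3) by (simp only: distrib_right sum.distrib)
  then show ?thesis unfolding linear_combinations_def using T(1,2) U(1,2)
    by (intro CollectI exI[of _ "T \<union> U"] exI[of _ ?c]) blast
qed

lemma linear_combinations_base:
  assumes "f \<in> S"
  shows "f \<in> linear_combinations S"
  unfolding linear_combinations_def using assms
  by (intro CollectI exI[of _ "{f}"] exI[of _ "\<lambda>_. 1"]) auto

lemma linear_combinations_sum: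
  assumes "\<And>i. i \<in> A \<Longrightarrow> f i \<in> linear_combinations S"
  shows "(\<lambda>x. \<Sum>i\<in>A. f i x) \<in> linear_combinations S"
proof -
  have "(\<lambda>x. 0) \<in> linear_combinations S"
    unfolding linear_combinations_def by (intro CollectI exI[of _ "{}"]) auto
  with assms show ?thesis
  proof (induction A rule: infinite_finite_induct)
    case (insert i A)
    then show ?case by (simp add: linear_combinations_add)
  qed simp_all
qed

lemma linear_combinations_mono: "S \<subseteq> S' \<Longrightarrow> linear_combinations S \<subseteq> linear_combinations S'"
  unfolding linear_combinations_def by blast

section \<open>First-order equations\<close>

text \<open>This carries information from one unit interval, or from one zero, to the whole line;
  the downward step divides by \<open>\<alpha>\<close>.\<close>

lemma multiplier_shift_int:
  fixes H :: "real \<Rightarrow> real"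
  assumes "\<alpha> \<noteq> 0" and H: "\<And>x. H (x + 1) = \<alpha> * H x"
  shows "H (x + of_int n) = \<alpha> powi n * H x"
proof (induction n rule: int_induct[where k = 0])
  case (step1 i)
  then show ?case
    using H[of "x + of_int i"] assms(1) by (simp add: power_int_add_1 add.assoc)
next
  case (step2 i)
  have "H (x + of_int i) = \<alpha> * H (x + of_int (i - 1))"
    using H[of "x + of_int (i - 1)"] by simp
  then show ?case using step2 assms(1) by (simp add: power_int_diff field_simps)
qed simp

text \<open>Each slope change in the fundamental domain \<open>[0, 1)\<close> is cancelled by the
  exponential centred there. The set \<open>B\<close> and the coefficients are exposed because the
  double-root argument attaches a separate floor factor to every summand.\<close>

lemma multiplier_solution_tropical_exp_sum:
  assumes \<alpha>: "\<alpha> \<noteq> 0" "\<alpha> \<noteq> 1" and tm: "tropical_meromorphic G"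
    and G: "\<And>x. G (x + 1) = \<alpha> * G x"
  obtains B a where "finite B" "B \<subseteq> {0..<1}"
    "\<And>x. G x = (\<Sum>b\<in>B. a b * tropical_exp \<alpha> (x - b))"
proof -
  define B where "B = slope_change_points G \<inter> {0..<1}"
  have "finite ({0..1} \<inter> slope_change_points G)"
    using tm unfolding tropical_meromorphic_def by (intro finite_not_islimpt_in_compact) auto
  then have fin: "finite B" by (rule rev_finite_subset) (auto simp: B_def)
  obtain l r where lr: "\<And>x. one_sided_slopes G x (l x) (r x)"
    using tm unfolding tropical_meromorphic_iff_slopes by metis
  define s :: real where "s = (if \<bar>\<alpha>\<bar> < 1 then - 1 else 1)"
  have "s \<noteq> 0" by (simp add: s_def)
  \<comment> \<open>The slope of \<open>e\<^sub>\<alpha>\<close> jumps at \<open>0\<close> from \<open>s / \<alpha>\<close> to \<open>s\<close>.\<close>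
  define a where "a b = (r b - l b) / (s * (1 - 1 / \<alpha>))" for b
  define H where "H x = G x - (\<Sum>b\<in>B. a b * tropical_exp \<alpha> (x - b))" for x
  have E_slopes: "one_sided_slopes (\<lambda>x. tropical_exp \<alpha> (x - b)) x
      (s * \<alpha> powi (\<lceil>x - b\<rceil> - 1)) (s * \<alpha> powi \<lfloor>x - b\<rfloor>)" for b x
    using one_sided_slopes_shift[of "tropical_exp \<alpha>" x "- b"]
      one_sided_slopes_tropical_exp[OF \<alpha>, of "x - b"] unfolding s_def by simp
  \<comment> \<open>Distinct points of \<open>[0, 1)\<close> never differ by an integer, so the
    exponential centred at \<open>b\<close> changes slope at no other point of the domain.\<close>
  have E_affine: "locally_affine_at (\<lambda>x. tropical_exp \<alpha> (x - b)) x"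
    if "x \<in> {0..<1}" "b \<in> {0..<1}" "x \<noteq> b" for x b
  proof -
    have "x - b \<notin> \<int>"
    proof
      assume "x - b \<in> \<int>"
      then obtain n where "x - b = of_int n" by (auto elim: Ints_cases)
      moreover have "- 1 < x - b" "x - b < 1" "x - b \<noteq> 0" using that by simp_all
      ultimately show False by simp
    qed
    then have "\<lceil>x - b\<rceil> - 1 = \<lfloor>x - b\<rfloor>" by (simp add: ceiling_altdef) (metis Ints_of_int)
    then show ?thesis
      using E_slopes[of b x] unfolding locally_affine_at_iff_slopes by metis
  qed
  have H_fund: "locally_affine_at H x" if x: "x \<in> {0..<1}" for x
  proof (cases "x \<in> B")
    case False
    have "locally_affine_at G x"
      using x False unfolding B_def slope_change_points_def by blast
    moreover have "locally_affine_at (\<lambda>x. \<Sum>b\<in>B. a b * tropical_exp \<alpha> (x - b)) x"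
      using x False by (intro locally_affine_at_sum locally_affine_at_cmult E_affine)
        (auto simp: B_def)
    ultimately show ?thesis
      using locally_affine_at_add[OF _ locally_affine_at_cmult[of _ x "- 1"]]
      unfolding H_def[abs_def] by fastforce
  next
    case True
    \<comment> \<open>Only the summand with \<open>b = x\<close> is non-affine here. Its slopes at
      its centre have exponents \<open>- 1\<close> and \<open>0\<close>, and \<open>a x\<close> is
      the coefficient that equates the two slopes after subtraction.\<close>
    have "one_sided_slopes (\<lambda>y. G y + - a x * tropical_exp \<alpha> (y - x)) x
        (l x + - a x * (s * inverse \<alpha>)) (r x + - a x * s)"
      using one_sided_slopes_add[OF lr one_sided_slopes_cmult[OF E_slopes[of x x], of "- a x"]]
      by (simp add: power_int_minus)
    moreover have "l x + - a x * (s * inverse \<alpha>) = r x + - a x * s"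
      using \<alpha> \<open>s \<noteq> 0\<close> by (simp add: a_def field_simps)
    ultimately have "locally_affine_at (\<lambda>y. G y + - a x * tropical_exp \<alpha> (y - x)) x"
      unfolding locally_affine_at_iff_slopes by metis
    moreover have "locally_affine_at (\<lambda>y. \<Sum>b\<in>B - {x}. a b * tropical_exp \<alpha> (y - b)) x"
      using x by (intro locally_affine_at_sum locally_affine_at_cmult E_affine)
        (auto simp: B_def)
    ultimately have "locally_affine_at (\<lambda>y. (G y + - a x * tropical_exp \<alpha> (y - x)) +
        - 1 * (\<Sum>b\<in>B - {x}. a b * tropical_exp \<alpha> (y - b))) x"
      by (rule locally_affine_at_add[OF _ locally_affine_at_cmult])
    moreover have "H = (\<lambda>y. (G y + - a x * tropical_exp \<alpha> (y - x)) +
        - 1 * (\<Sum>b\<in>B - {x}. a b * tropical_exp \<alpha> (y - b)))"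
      unfolding H_def[abs_def] sum.remove[OF fin True] by (simp add: algebra_simps)
    ultimately show ?thesis by simp
  qed
  have H1: "H (x + 1) = \<alpha> * H x" for x
    unfolding H_def G using tropical_exp_plus_1[OF \<alpha>(1), of "x - _"]
    by (simp add: sum_distrib_left algebra_simps)
  have "locally_affine_at H x" for x
  proof -
    \<comment> \<open>The integer \<open>\<lfloor>x\<rfloor>\<close> stays fixed while the argument
      varies, so \<open>H\<close> is a constant multiple of its translate, which is affine near
      \<open>x\<close> because \<open>H\<close> is affine near a point of
      \<open>[0, 1)\<close>.\<close>
    have "locally_affine_at H (x + of_int (- \<lfloor>x\<rfloor>))"
      by (rule H_fund) (auto, linarith)
    from locally_affine_at_cmult[OF locally_affine_at_shift[OF this], of "\<alpha> powi \<lfloor>x\<rfloor>"]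
    show ?thesis
      using multiplier_shift_int[of \<alpha> H _ "- \<lfloor>x\<rfloor>", OF \<alpha>(1) H1] \<alpha>(1)
      by (simp add: power_int_minus mult.assoc[symmetric])
  qed
  then obtain m k where mk: "\<And>x. H x = m * x + k"
    using locally_affine_on_imp_affine[of UNIV H] by auto
  \<comment> \<open>The first-order equation at 0 and 1, once subtracted, gives
    \<open>m = \<alpha> * m\<close>; \<open>\<alpha> \<noteq> 1\<close> then kills \<open>m\<close>
    and after it \<open>k\<close>.\<close>
  have eqs: "m + k = \<alpha> * k" "2 * m + k = \<alpha> * (m + k)"
    using H1[of 0] H1[of 1] by (simp_all add: mk)
  then have "m = \<alpha> * m" unfolding distrib_left by linarith
  then have "m = 0" using \<alpha> by simp
  then have "k = 0" using eqs \<alpha> by simp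
  have "G x = (\<Sum>b\<in>B. a b * tropical_exp \<alpha> (x - b))" for x
    using mk[of x] \<open>m = 0\<close> \<open>k = 0\<close> by (simp add: H_def)
  then show thesis using that[OF fin] by (auto simp: B_def)
qed

lemma multiplier_solution_in_linear_combinations:
  assumes "\<alpha> \<noteq> 0" "\<alpha> \<noteq> 1" "tropical_meromorphic G" "\<And>x. G (x + 1) = \<alpha> * G x"
  shows "G \<in> linear_combinations {(\<lambda>x. tropical_exp \<alpha> (x - b)) | b. b \<in> {0..<1}}"
proof -
  obtain B a where "B \<subseteq> {0..<1}" and G: "\<And>x. G x = (\<Sum>b\<in>B. a b * tropical_exp \<alpha> (x - b))"
    using multiplier_solution_tropical_exp_sum[of \<alpha> G, OF assms] by metis
  then have "(\<lambda>x. \<Sum>b\<in>B. a b * tropical_exp \<alpha> (x - b))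
      \<in> linear_combinations {(\<lambda>x. tropical_exp \<alpha> (x - b)) | b. b \<in> {0..<1}}"
    by (intro linear_combinations_sum linear_combinations_cmult linear_combinations_base) blast
  then show ?thesis using G by presburger
qed

section \<open>Second-order equations\<close>

lemma solution_first_order_factor:
  assumes "tropical_meromorphic_solution (\<alpha> + \<beta>) (\<alpha> * \<beta>) F"
  shows "tropical_meromorphic (\<lambda>x. F (x + 1) - \<beta> * F x)"
    and "F (x + 1 + 1) - \<beta> * F (x + 1) = \<alpha> * (F (x + 1) - \<beta> * F x)"
proof -
  have F: "tropical_meromorphic F" "F (x + 1 + 1) - (\<alpha> + \<beta>) * F (x + 1) + \<alpha> * \<beta> * F (x + 1 - 1) = 0"
    using assms unfolding tropical_meromorphic_solution_def by blast+
  from F(1) show "tropical_meromorphic (\<lambda>x. F (x + 1) - \<beta> * F x)"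
    by (intro tropical_meromorphic_diff tropical_meromorphic_shift tropical_meromorphic_cmult)
  from F(2) show "F (x + 1 + 1) - \<beta> * F (x + 1) = \<alpha> * (F (x + 1) - \<beta> * F x)"
    by (simp add: algebra_simps)
qed

text \<open>The difference \<open>F (x + 1) - F x\<close> is 1-periodic. Its value \<open>k\<close>
  at 0 is produced by \<open>k * x\<close>; the remainder \<open>P0\<close> vanishes at the
  integers, so \<open>\<lfloor>x\<rfloor> * P0 x\<close> is continuous and has increment
  \<open>P0 x\<close>. What is left of \<open>F\<close> is 1-periodic.\<close>

lemma solution_double_root_1:
  assumes "tropical_meromorphic_solution 2 1 F"
  shows "F \<in> linear_combinations
            ({P. tropical_meromorphic P \<and> periodic 1 P}
             \<union> {\<lambda>x. x}
             \<union> {(\<lambda>x. of_int \<lfloor>x\<rfloor> * P\<^sub>0 x) | P\<^sub>0.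
                  tropical_meromorphic P\<^sub>0 \<and> periodic 1 P\<^sub>0 \<and> P\<^sub>0 0 = 0})"
    (is "_ \<in> linear_combinations ?S")
proof -
  have tmF: "tropical_meromorphic F" using assms by (simp add: tropical_meromorphic_solution_def)
  define k where "k = F 1 - F 0"
  define P0 where "P0 x = F (x + 1) - F x - k" for x
  define P where "P x = F x - k * x - of_int \<lfloor>x\<rfloor> * P0 x" for x
  have tmP0: "tropical_meromorphic P0"
    using tropical_meromorphic_diff[OF solution_first_order_factor(1)[of 1 1 F]
        tropical_meromorphic_affine[of 0 k]] assms
    unfolding P0_def[abs_def] by simp
  have P0_1: "P0 (x + 1) = P0 x" for x
    using solution_first_order_factor(2)[of 1 1 F x] assms by (simp add: P0_def)
  have "P0 (of_int n) = 0" for n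
    using multiplier_shift_int[of 1 P0 0 n] P0_1 by (simp add: P0_def k_def)
  then have tmfl: "tropical_meromorphic (\<lambda>x. of_int \<lfloor>x\<rfloor> * P0 x)"
    using tropical_meromorphic_floor_mult[OF tmP0, of 0] by simp
  have "tropical_meromorphic P"
    using tropical_meromorphic_diff[OF
        tropical_meromorphic_diff[OF tmF tropical_meromorphic_affine[of k 0]] tmfl]
    unfolding P_def[abs_def] by simp
  moreover have "P (x + 1) = P x" for x
  proof -
    have "P (x + 1) = P x + (F (x + 1) - F x - k - P0 x)"
      unfolding P_def P0_1 by (simp add: algebra_simps)
    then show ?thesis by (simp add: P0_def)
  qed
  ultimately have "P \<in> ?S" by (simp add: periodic_def)
  moreover have "(\<lambda>x. of_int \<lfloor>x\<rfloor> * P0 x) \<in> ?S"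
  proof -
    have "periodic 1 P0" "P0 0 = 0" using P0_1 by (simp_all add: periodic_def P0_def k_def)
    with tmP0 show ?thesis by blast
  qed
  moreover have "(\<lambda>x. x) \<in> ?S" by blast
  ultimately have "(\<lambda>x. P x + (k * x + of_int \<lfloor>x\<rfloor> * P0 x)) \<in> linear_combinations ?S"
    by (intro linear_combinations_add linear_combinations_cmult[of "\<lambda>x. x"]
        linear_combinations_base)
  then show ?thesis by (simp add: P_def)
qed

lemma solution_double_root_minus_1:
  assumes "tropical_meromorphic_solution (- 2) 1 F"
  shows "F \<in> linear_combinations
            {f. tropical_meromorphic f \<and>
                (periodic 2 f \<and> anti_periodic 1 f \<or>
                 (\<exists>x\<^sub>0 \<Xi>. tropical_meromorphic \<Xi> \<and> periodic 2 \<Xi> \<and> anti_periodic 1 \<Xi> \<and>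
                    \<Xi> x\<^sub>0 = 0 \<and> f = (\<lambda>x. of_int \<lfloor>x - x\<^sub>0\<rfloor> * \<Xi> x)))}"
    (is "_ \<in> linear_combinations ?S")
proof -
  have tmF: "tropical_meromorphic F" using assms by (simp add: tropical_meromorphic_solution_def)
  have per2: "periodic 2 f" if f: "\<And>x. f (x + 1) = - f x" for f
    using f[of "_ + 1"] f unfolding periodic_def by (simp add: add.assoc)
  \<comment> \<open>The sign compensates for anti-periodicity: the floor product below satisfies
    \<open>g (x + 1) = - g x - X x\<close>, so \<open>g (x + 1) + g x\<close> equals
    \<open>F (x + 1) + F x\<close>.\<close>
  define X where "X x = - (F (x + 1) + F x)" for x
  have tmX: "tropical_meromorphic X"
    using tropical_meromorphic_cmult[OF solution_first_order_factor(1)[of "- 1" "- 1" F], of "- 1"]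
      assms unfolding X_def[abs_def] by simp
  have X1: "X (x + 1) = - X x" for x
    using solution_first_order_factor(2)[of "- 1" "- 1" F x] assms by (simp add: X_def)
  have contX: "continuous_on {0..1} X"
    using tmX continuous_on_subset unfolding tropical_meromorphic_def by blast
  \<comment> \<open>Anti-periodicity gives \<open>X 1 = - X 0\<close>, so the intermediate value
    theorem yields a zero in \<open>[0, 1]\<close>.\<close>
  obtain x0 where x0: "X x0 = 0"
  proof (cases "X 0 \<le> 0")
    case True
    then show thesis using IVT'[of X 0 0 1, OF _ _ _ contX] X1[of 0] that by auto
  next
    case False
    then show thesis using IVT2'[of X 1 0 0, OF _ _ _ contX] X1[of 0] that by auto
  qed
  define g where "g x = of_int \<lfloor>x - x0\<rfloor> * X x" for x
  define P where "P x = F x - g x" for x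
  have "X (x0 + of_int n) = 0" for n
    using multiplier_shift_int[of "- 1" X x0 n] X1 x0 by simp
  then have tmg: "tropical_meromorphic g"
    unfolding g_def[abs_def] by (rule tropical_meromorphic_floor_mult[OF tmX])
  have "tropical_meromorphic P"
    unfolding P_def[abs_def] by (rule tropical_meromorphic_diff[OF tmF tmg])
  moreover have P1: "P (x + 1) = - P x" for x
  proof -
    have "\<lfloor>x + 1 - x0\<rfloor> = \<lfloor>x - x0\<rfloor> + 1" using floor_add_int[of "x - x0" 1]
      by (simp add: algebra_simps)
    then have "P (x + 1) = - P x + (F (x + 1) + F x + X x)"
      unfolding P_def g_def X1 by (simp add: algebra_simps)
    then show ?thesis by (simp add: X_def)
  qed
  ultimately have "P \<in> ?S" using per2[of P, OF P1] by (simp add: anti_periodic_def)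
  moreover have "g \<in> ?S"
    using tmX tmg per2[of X, OF X1] X1 x0 unfolding g_def[abs_def] anti_periodic_def by blast
  ultimately have "(\<lambda>x. P x + g x) \<in> linear_combinations ?S"
    by (intro linear_combinations_add linear_combinations_base)
  then show ?thesis by (simp add: P_def)
qed

text \<open>A negative \<open>\<gamma>\<close> gives the exponential a zero inside
  \<open>(0, 1)\<close>, where a floor factor may jump. For positive
  \<open>\<gamma> \<noteq> 1\<close> it has no zeros, so the construction depends on the
  sign.\<close>

lemma solution_double_root_negative:
  assumes \<gamma>: "\<gamma> < 0" and sol: "tropical_meromorphic_solution (2 * \<gamma>) (\<gamma>\<^sup>2) F"
  shows "F \<in> linear_combinations
            ({(\<lambda>x. tropical_exp \<gamma> (x - b)) | b. b \<in> {0..<1}}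
             \<union> {(\<lambda>x. of_int \<lfloor>x - b\<^sub>0\<rfloor> * tropical_exp \<gamma> (x - b)) | b b\<^sub>0.
                  b \<in> {0..<1} \<and> tropical_exp \<gamma> (b\<^sub>0 - b) = 0})"
    (is "_ \<in> linear_combinations (?E \<union> ?M)")
proof -
  have tmF: "tropical_meromorphic F" using sol by (simp add: tropical_meromorphic_solution_def)
  have sol': "tropical_meromorphic_solution (\<gamma> + \<gamma>) (\<gamma> * \<gamma>) F"
    using sol by (simp add: power2_eq_square)
  obtain B a where B: "B \<subseteq> {0..<1}"
    and G: "\<And>x. F (x + 1) - \<gamma> * F x = (\<Sum>b\<in>B. a b * tropical_exp \<gamma> (x - b))"
    using multiplier_solution_tropical_exp_sum[of _ "\<lambda>x. F (x + 1) - \<gamma> * F x",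
        OF _ _ solution_first_order_factor[OF sol']] \<gamma>
    by (metis less_numeral_extra(3) not_one_less_zero)
  \<comment> \<open>On \<open>[0, 1)\<close> the exponential is, up to sign,
    \<open>x + 1 / (\<gamma> - 1)\<close>; this is its zero.\<close>
  define z where "z = 1 / (1 - \<gamma>)"
  have "0 < z" "z < 1" using \<gamma> by (auto simp: z_def)
  then have "\<lfloor>z\<rfloor> = 0" by linarith
  then have z: "tropical_exp \<gamma> z = 0"
    using \<gamma> by (simp add: tropical_exp_altdef) (simp add: z_def divide_simps)
  define g where "g b x = of_int \<lfloor>x - (b + z)\<rfloor> * tropical_exp \<gamma> (x - b)" for b x
  have g1: "g b (x + 1) = \<gamma> * (g b x + tropical_exp \<gamma> (x - b))" for b x
  proof -
    have "\<lfloor>x + 1 - (b + z)\<rfloor> = \<lfloor>x - (b + z)\<rfloor> + 1" using floor_add_int[of "x - (b + z)" 1]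
      by (simp add: algebra_simps)
    then show ?thesis using tropical_exp_plus_1[of \<gamma> "x - b"] \<gamma>
      by (simp add: g_def algebra_simps)
  qed
  have tmg: "tropical_meromorphic (g b)" for b
    unfolding g_def[abs_def]
  proof (rule tropical_meromorphic_floor_mult)
    show "tropical_meromorphic (\<lambda>x. tropical_exp \<gamma> (x - b))"
      using \<gamma> by (intro tropical_meromorphic_tropical_exp) auto
    show "tropical_exp \<gamma> (b + z + of_int n - b) = 0" for n
      using multiplier_shift_int[of \<gamma> "tropical_exp \<gamma>" z n] tropical_exp_plus_1[of \<gamma>] \<gamma> z by simp
  qed
  \<comment> \<open>The increment \<open>g b (x + 1) - \<gamma> * g b x\<close> is
    \<open>\<gamma>\<close> times the exponential, hence the division by \<open>\<gamma>\<close>. So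
    \<open>K (x + 1) - \<gamma> * K x\<close> matches the same expression in \<open>F\<close>, and
    \<open>H\<close> has multiplier \<open>\<gamma>\<close>.\<close>
  define K where "K x = (\<Sum>b\<in>B. (a b / \<gamma>) * g b x)" for x
  define H where "H x = F x - K x" for x
  have "tropical_meromorphic H"
    unfolding H_def[abs_def] K_def
    by (intro tropical_meromorphic_diff tmF tropical_meromorphic_sum tropical_meromorphic_cmult tmg)
  moreover have "H (x + 1) = \<gamma> * H x" for x
  proof -
    have "K (x + 1) = (\<Sum>b\<in>B. \<gamma> * (a b / \<gamma> * g b x) + a b * tropical_exp \<gamma> (x - b))"
      unfolding K_def g1 using \<gamma> by (intro sum.cong) (auto simp: field_simps)
    also have "\<dots> = \<gamma> * K x + (F (x + 1) - \<gamma> * F x)"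
      by (simp only: G K_def sum.distrib sum_distrib_left)
    finally show ?thesis by (simp add: H_def algebra_simps)
  qed
  ultimately have "H \<in> linear_combinations ?E"
    using \<gamma> by (intro multiplier_solution_in_linear_combinations) auto
  then have "H \<in> linear_combinations (?E \<union> ?M)"
    using linear_combinations_mono[of ?E "?E \<union> ?M"] by blast
  moreover have "g b \<in> ?M" if "b \<in> B" for b
    using B that z unfolding g_def[abs_def] by (intro CollectI exI[of _ b] exI[of _ "b + z"]) auto
  then have "K \<in> linear_combinations (?E \<union> ?M)"
    unfolding K_def[abs_def]
    by (intro linear_combinations_sum linear_combinations_cmult linear_combinations_base) blast
  ultimately have "(\<lambda>x. H x + K x) \<in> linear_combinations (?E \<union> ?M)"
    by (rule linear_combinations_add)
  then show ?thesis by (simp add: H_def)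
qed

text \<open>The first-order equation with multiplier \<open>\<gamma>\<close> passes to sums. Used at
  \<open>x\<close> and \<open>x - 1\<close>, it turns the second-order expression into
  \<open>\<gamma> * F x - 2 * \<gamma> * F x + \<gamma> * F x\<close>.\<close>

lemma tropical_exp_combination_solution:
  assumes \<gamma>: "\<gamma> \<noteq> 0" "\<gamma> \<noteq> 1"
    and F: "F \<in> linear_combinations {(\<lambda>x. tropical_exp \<gamma> (x - b)) | b. b \<in> {0..<1}}"
  shows "tropical_meromorphic_solution (2 * \<gamma>) (\<gamma>\<^sup>2) F"
proof -
  obtain T a where T: "T \<subseteq> {(\<lambda>x. tropical_exp \<gamma> (x - b)) | b. b \<in> {0..<1}}"
    and F: "F = (\<lambda>x. \<Sum>g\<in>T. a g * g x)"
    using F unfolding linear_combinations_def by blast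
  have "tropical_meromorphic g" if "g \<in> T" for g
    using T that tropical_meromorphic_tropical_exp[OF \<gamma>] by blast
  then have "tropical_meromorphic F"
    unfolding F by (intro tropical_meromorphic_sum tropical_meromorphic_cmult) auto
  moreover have "g (x + 1) = \<gamma> * g x" if "g \<in> T" for g x
  proof -
    have "g \<in> {(\<lambda>x. tropical_exp \<gamma> (x - b)) | b. b \<in> {0..<1}}" using T that by blast
    then obtain b where "g = (\<lambda>x. tropical_exp \<gamma> (x - b))" by auto
    then show ?thesis using tropical_exp_plus_1[OF \<gamma>(1), of "x - b"] by (simp add: algebra_simps)
  qed
  then have F1: "F (x + 1) = \<gamma> * F x" for x
    unfolding F sum_distrib_left by (intro sum.cong) simp_all
  have "F (x + 1) - 2 * \<gamma> * F x + \<gamma>\<^sup>2 * F (x - 1) = 0" for x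
    using F1[of x] F1[of "x - 1"] by (simp add: power2_eq_square)
  ultimately show ?thesis unfolding tropical_meromorphic_solution_def by blast
qed

lemma solution_distinct_roots:
  assumes \<alpha>: "\<alpha> \<noteq> 0" "\<alpha> \<noteq> 1" and \<beta>: "\<beta> \<noteq> 0" "\<beta> \<noteq> 1" and "\<alpha> \<noteq> \<beta>"
    and sol: "tropical_meromorphic_solution (\<alpha> + \<beta>) (\<alpha> * \<beta>) F"
  shows "F \<in> linear_combinations
               ({(\<lambda>x. tropical_exp \<alpha> (x - b)) | b. b \<in> {0..<1}}
                \<union> {(\<lambda>x. tropical_exp \<beta> (x - b)) | b. b \<in> {0..<1}})"
    (is "_ \<in> linear_combinations (?A \<union> ?B)")
proof -
  have "(\<lambda>x. F (x + 1) - \<beta> * F x) \<in> linear_combinations ?A"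
    by (rule multiplier_solution_in_linear_combinations[of _ "\<lambda>x. F (x + 1) - \<beta> * F x",
          OF \<alpha> solution_first_order_factor[OF sol]])
  then have 1: "(\<lambda>x. F (x + 1) - \<beta> * F x) \<in> linear_combinations (?A \<union> ?B)"
    using linear_combinations_mono[of ?A "?A \<union> ?B"] by blast
  \<comment> \<open>The equation is symmetric in the roots; exchanging them gives the expression
    with multiplier \<open>\<beta>\<close>.\<close>
  have sol': "tropical_meromorphic_solution (\<beta> + \<alpha>) (\<beta> * \<alpha>) F"
    using sol by (simp only: add.commute mult.commute)
  have "(\<lambda>x. F (x + 1) - \<alpha> * F x) \<in> linear_combinations ?B"
    by (rule multiplier_solution_in_linear_combinations[of _ "\<lambda>x. F (x + 1) - \<alpha> * F x",
          OF \<beta> solution_first_order_factor[OF sol']])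
  then have 2: "(\<lambda>x. F (x + 1) - \<alpha> * F x) \<in> linear_combinations (?A \<union> ?B)"
    using linear_combinations_mono[of ?B "?A \<union> ?B"] by blast
  have "(\<lambda>x. 1 / (\<alpha> - \<beta>) * ((F (x + 1) - \<beta> * F x) + - 1 * (F (x + 1) - \<alpha> * F x)))
      \<in> linear_combinations (?A \<union> ?B)"
    by (intro linear_combinations_cmult linear_combinations_add 1 2)
  moreover have "(F (x + 1) - \<beta> * F x) + - 1 * (F (x + 1) - \<alpha> * F x) = (\<alpha> - \<beta>) * F x" for x
    by (simp add: algebra_simps)
  ultimately show ?thesis using \<open>\<alpha> \<noteq> \<beta>\<close> by simp
qed

section \<open>The five coefficient cases in terms of characteristic roots\<close>

theorem theorem5p1:
  fixes c d :: real
  shows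
    "(c = 2 \<and> d = 1 \<longrightarrow>
       (\<forall>F. tropical_meromorphic_solution c d F \<longrightarrow>
          F \<in> linear_combinations
            ({P. tropical_meromorphic P \<and> periodic 1 P}
             \<union> {\<lambda>x. x}
             \<union> {(\<lambda>x. of_int \<lfloor>x\<rfloor> * P\<^sub>0 x) | P\<^sub>0.
                  tropical_meromorphic P\<^sub>0 \<and> periodic 1 P\<^sub>0 \<and> P\<^sub>0 0 = 0})))
     \<and>
     (c = - 2 \<and> d = 1 \<longrightarrow>
       (\<forall>F. tropical_meromorphic_solution c d F \<longrightarrow>
          F \<in> linear_combinations
            {f. tropical_meromorphic f \<and>
                (periodic 2 f \<and> anti_periodic 1 f \<or>
                 (\<exists>x\<^sub>0 \<Xi>. tropical_meromorphic \<Xi> \<and> periodic 2 \<Xi> \<and> anti_periodic 1 \<Xi> \<and>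
                    \<Xi> x\<^sub>0 = 0 \<and> f = (\<lambda>x. of_int \<lfloor>x - x\<^sub>0\<rfloor> * \<Xi> x)))}))
     \<and>
     (c\<^sup>2 - 4 * d = 0 \<and> d \<noteq> 0 \<and> d \<noteq> 1 \<and> c < 0 \<longrightarrow>
       (\<forall>F. tropical_meromorphic_solution c d F \<longrightarrow>
          F \<in> linear_combinations
            ({(\<lambda>x. tropical_exp (c / 2) (x - b)) | b. b \<in> {0..<1}}
             \<union> {(\<lambda>x. of_int \<lfloor>x - b\<^sub>0\<rfloor> * tropical_exp (c / 2) (x - b)) | b b\<^sub>0.
                  b \<in> {0..<1} \<and> tropical_exp (c / 2) (b\<^sub>0 - b) = 0})))
     \<and>
     (c\<^sup>2 - 4 * d = 0 \<and> d \<noteq> 0 \<and> d \<noteq> 1 \<and> c > 0 \<longrightarrow>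
       (\<forall>F \<in> linear_combinations {(\<lambda>x. tropical_exp (c / 2) (x - b)) | b. b \<in> {0..<1}}.
          tropical_meromorphic_solution c d F))
     \<and>
     (c\<^sup>2 - 4 * d > 0 \<and> d \<noteq> 0 \<and> d \<noteq> 1 \<and> 1 - c + d \<noteq> 0 \<longrightarrow>
       (\<exists>\<alpha> \<beta>. \<alpha> \<noteq> \<beta> \<and> {l. l\<^sup>2 - c * l + d = 0} = {\<alpha>, \<beta>} \<and>
          (\<forall>F. tropical_meromorphic_solution c d F \<longrightarrow>
             F \<in> linear_combinations
               ({(\<lambda>x. tropical_exp \<alpha> (x - b)) | b. b \<in> {0..<1}}
                \<union> {(\<lambda>x. tropical_exp \<beta> (x - b)) | b. b \<in> {0..<1}}))))"
proof (intro conjI impI)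
  assume "c = 2 \<and> d = 1"
  then show "\<forall>F. tropical_meromorphic_solution c d F \<longrightarrow>
          F \<in> linear_combinations
            ({P. tropical_meromorphic P \<and> periodic 1 P}
             \<union> {\<lambda>x. x}
             \<union> {(\<lambda>x. of_int \<lfloor>x\<rfloor> * P\<^sub>0 x) | P\<^sub>0.
                  tropical_meromorphic P\<^sub>0 \<and> periodic 1 P\<^sub>0 \<and> P\<^sub>0 0 = 0})"
    using solution_double_root_1 by blast
next
  assume "c = - 2 \<and> d = 1"
  then show "\<forall>F. tropical_meromorphic_solution c d F \<longrightarrow>
          F \<in> linear_combinations
            {f. tropical_meromorphic f \<and>
                (periodic 2 f \<and> anti_periodic 1 f \<or>
                 (\<exists>x\<^sub>0 \<Xi>. tropical_meromorphic \<Xi> \<and> periodic 2 \<Xi> \<and> anti_periodic 1 \<Xi> \<and>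
                    \<Xi> x\<^sub>0 = 0 \<and> f = (\<lambda>x. of_int \<lfloor>x - x\<^sub>0\<rfloor> * \<Xi> x)))}"
    using solution_double_root_minus_1 by blast
next
  assume "c\<^sup>2 - 4 * d = 0 \<and> d \<noteq> 0 \<and> d \<noteq> 1 \<and> c < 0"
  then have "2 * (c / 2) = c" "(c / 2)\<^sup>2 = d" "c / 2 < 0" by (auto simp: power_divide)
  then show "\<forall>F. tropical_meromorphic_solution c d F \<longrightarrow>
          F \<in> linear_combinations
            ({(\<lambda>x. tropical_exp (c / 2) (x - b)) | b. b \<in> {0..<1}}
             \<union> {(\<lambda>x. of_int \<lfloor>x - b\<^sub>0\<rfloor> * tropical_exp (c / 2) (x - b)) | b b\<^sub>0.
                  b \<in> {0..<1} \<and> tropical_exp (c / 2) (b\<^sub>0 - b) = 0})"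
    using solution_double_root_negative[of "c / 2"] by simp
next
  assume "c\<^sup>2 - 4 * d = 0 \<and> d \<noteq> 0 \<and> d \<noteq> 1 \<and> c > 0"
  \<comment> \<open>The value \<open>c / 2 = 1\<close> would force \<open>d = 1\<close>, which is
    excluded.\<close>
  then have eqs: "2 * (c / 2) = c" "(c / 2)\<^sup>2 = d" and ne: "c / 2 \<noteq> 0" "c / 2 \<noteq> 1"
    by (auto simp: power_divide)
  show "\<forall>F \<in> linear_combinations {(\<lambda>x. tropical_exp (c / 2) (x - b)) | b. b \<in> {0..<1}}.
          tropical_meromorphic_solution c d F"
    using tropical_exp_combination_solution[OF ne] unfolding eqs by blast
next
  assume asm: "c\<^sup>2 - 4 * d > 0 \<and> d \<noteq> 0 \<and> d \<noteq> 1 \<and> 1 - c + d \<noteq> 0"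
  define \<alpha> \<beta> where "\<alpha> = (c + sqrt (c\<^sup>2 - 4 * d)) / 2" and "\<beta> = (c - sqrt (c\<^sup>2 - 4 * d)) / 2"
  have "sqrt (c\<^sup>2 - 4 * d) > 0" using asm by simp
  then have "\<alpha> \<noteq> \<beta>" by (auto simp: \<alpha>_def \<beta>_def)
  have sum: "c = \<alpha> + \<beta>" by (simp add: \<alpha>_def \<beta>_def field_simps)
  have "(sqrt (c\<^sup>2 - 4 * d))\<^sup>2 = c\<^sup>2 - 4 * d" using asm by simp
  then have prod: "d = \<alpha> * \<beta>"
    by (simp add: \<alpha>_def \<beta>_def field_simps power2_eq_square)
  have "l\<^sup>2 - c * l + d = (l - \<alpha>) * (l - \<beta>)" for l
    unfolding sum prod by (simp add: algebra_simps power2_eq_square)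
  then have "{l. l\<^sup>2 - c * l + d = 0} = {\<alpha>, \<beta>}" by auto
  moreover have "\<alpha> \<noteq> 0" "\<beta> \<noteq> 0" using asm prod by auto
  \<comment> \<open>The number \<open>1 - c + d\<close> is the characteristic polynomial at 1, so
    its non-vanishing excludes the root 1, just as \<open>d \<noteq> 0\<close> excludes the root
    0.\<close>
  moreover have "(1 - \<alpha>) * (1 - \<beta>) \<noteq> 0"
    using asm unfolding sum prod by (simp add: algebra_simps)
  then have "\<alpha> \<noteq> 1" "\<beta> \<noteq> 1" by auto
  ultimately show "\<exists>\<alpha> \<beta>. \<alpha> \<noteq> \<beta> \<and> {l. l\<^sup>2 - c * l + d = 0} = {\<alpha>, \<beta>} \<and>
          (\<forall>F. tropical_meromorphic_solution c d F \<longrightarrow>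
             F \<in> linear_combinations
               ({(\<lambda>x. tropical_exp \<alpha> (x - b)) | b. b \<in> {0..<1}}
                \<union> {(\<lambda>x. tropical_exp \<beta> (x - b)) | b. b \<in> {0..<1}}))"
    using solution_distinct_roots[of \<alpha> \<beta>] \<open>\<alpha> \<noteq> \<beta>\<close> unfolding sum prod
    by (intro exI[of _ \<alpha>] exI[of _ \<beta>]) simp
qed

end
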